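(* Let $\Sigma$ be a finite alphabet and let $\rho\in(0,1)$. Let $P_1,P_2,Q\in\Sigma^*$ be strings of lengths $m_1$, $m_2$ and $n$ respectively, and let $\ell$ be a positive integer. Then $$d_\rho(P_1QP_2,\,P_1Q^\ell P_2)\le\frac{\pi}{\sqrt{2L}}\left(3A_{M}(\rho)+\frac{\rho}{1-\rho}\,r\right)+\frac{\pi}{2}\cdot\frac{\rho^{K+1}}{1-\rho}+\frac{\pi}{2}\cdot\frac{\rho^{L+1}(1-\rho^r)}{1-\rho},$$ where $L=m_1+n+m_2$, $r=(\ell-1)n$, $K=\lfloor L/2\rfloor$, $M=\min(m_1+n+1,\,m_2+1)$, and $$A_M(\rho)=\sum_{k=1}^\infty\rho^k\min(k,M)=\frac{\rho\bigl(1-(M+1)\rho^M+M\rho^{M+1}\bigr)}{(1-\rho)^2}+\frac{M\rho^{M+1}}{1-\rho}.$$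
   Context: $\Sigma$ is a finite set of characters; $\Sigma^k$ is the set of strings of length $k$ over $\Sigma$, and $\Sigma^*=\bigsqcup_{k\ge 0}\Sigma^k$; juxtaposition denotes concatenation, $Q^\ell$ is the concatenation of $\ell$ copies of $Q$, and $|S|$ denotes the length of $S$. For strings $S,X$, the multiplicity $c(S,X)$ is the number of pairs $(R_1,R_2)$ of strings with $S=R_1XR_2$. For $k\ge 1$, $[S]_k\in\mathbb{R}^{\Sigma^k}$ is the $k$-gram count vector $[S]_k(X)=c(S,X)$ for $X\in\Sigma^k$. For vectors $u,v$ with nonnegative entries, $\theta(u,v)=\arccos\left(\frac{u\cdot v}{\|u\|\|v\|}\right)$ if $u,v\ne 0$, $\theta(u,v)=0$ if $u=v=0$, and $\theta(u,v)=\pi/2$ if exactly one of $u,v$ is $0$. Set $\theta_k(S,T)=\theta([S]_k,[T]_k)$ and $d_\rho(S,T)=\sum_{k\ge 1}\rho^k\theta_k(S,T)$. *)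

theory Defs
  imports "HOL-Analysis.Analysis"
begin

definition words :: "'a set \<Rightarrow> nat \<Rightarrow> 'a list set" where
  "words \<Sigma> k = {X. set X \<subseteq> \<Sigma> \<and> length X = k}"

definition multiplicity :: "'a list \<Rightarrow> 'a list \<Rightarrow> nat" where
  "multiplicity S X = card {(R1, R2). S = R1 @ X @ R2}"

definition word_power :: "'a list \<Rightarrow> nat \<Rightarrow> 'a list" where
  "word_power Q l = concat (replicate l Q)"

text \<open>A vector indexed by a finite set \<open>I\<close> is a function of which only the values on \<open>I\<close> matter;
  \<open>L2_set u I\<close> is its Euclidean norm.\<close>

definition zero_vec_on :: "'i set \<Rightarrow> ('i \<Rightarrow> real) \<Rightarrow> bool" where
  "zero_vec_on I u \<longleftrightarrow> (\<forall>i\<in>I. u i = 0)"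

definition angle_on :: "'i set \<Rightarrow> ('i \<Rightarrow> real) \<Rightarrow> ('i \<Rightarrow> real) \<Rightarrow> real" where
  "angle_on I u v =
     (if zero_vec_on I u \<and> zero_vec_on I v then 0
      else if zero_vec_on I u \<or> zero_vec_on I v then pi / 2
      else arccos ((\<Sum>i\<in>I. u i * v i) / (L2_set u I * L2_set v I)))"

definition kgram_vec :: "'a list \<Rightarrow> 'a list \<Rightarrow> real" where
  "kgram_vec S X = real (multiplicity S X)"

definition kgram_angle :: "'a set \<Rightarrow> nat \<Rightarrow> 'a list \<Rightarrow> 'a list \<Rightarrow> real" where
  "kgram_angle \<Sigma> k S T = angle_on (words \<Sigma> k) (kgram_vec S) (kgram_vec T)"

text \<open>The series below start at 1, hence the shift by \<open>Suc\<close>.\<close>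

definition d_rho :: "'a set \<Rightarrow> real \<Rightarrow> 'a list \<Rightarrow> 'a list \<Rightarrow> real" where
  "d_rho \<Sigma> \<rho> S T = (\<Sum>k. \<rho> ^ Suc k * kgram_angle \<Sigma> (Suc k) S T)"

definition A_series :: "nat \<Rightarrow> real \<Rightarrow> real" where
  "A_series M \<rho> = (\<Sum>k. \<rho> ^ Suc k * real (min (Suc k) M))"

text \<open>For \<open>0 < \<rho> < 1\<close> both series converge, so \<open>suminf\<close> denotes their actual sums.\<close>

lemma angle_on_bounds: "0 \<le> angle_on I u v \<and> angle_on I u v \<le> pi"
proof -
  have "\<bar>(\<Sum>i\<in>I. u i * v i) / (L2_set u I * L2_set v I)\<bar> \<le> 1"
  proof -
    have "\<bar>\<Sum>i\<in>I. u i * v i\<bar> \<le> (\<Sum>i\<in>I. \<bar>u i\<bar> * \<bar>v i\<bar>)"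
      by (rule order_trans[OF sum_abs]) (simp add: abs_mult)
    also have "\<dots> \<le> L2_set u I * L2_set v I"
      by (rule L2_set_mult_ineq)
    finally have le: "\<bar>\<Sum>i\<in>I. u i * v i\<bar> \<le> L2_set u I * L2_set v I" .
    moreover have "0 \<le> L2_set u I * L2_set v I"
      by (intro mult_nonneg_nonneg L2_set_nonneg)
    ultimately show ?thesis
      unfolding abs_divide divide_le_eq_1 by linarith
  qed
  then have "-1 \<le> (\<Sum>i\<in>I. u i * v i) / (L2_set u I * L2_set v I)"
    and "(\<Sum>i\<in>I. u i * v i) / (L2_set u I * L2_set v I) \<le> 1"
    by linarith+
  then show ?thesis
    unfolding angle_on_def using arccos_lbound arccos_ubound by simp
qed

lemma d_rho_summable:
  assumes "0 < \<rho>" "\<rho> < 1"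
  shows "summable (\<lambda>k. \<rho> ^ Suc k * kgram_angle \<Sigma> (Suc k) S T)"
proof (rule summable_comparison_test'[where g = "\<lambda>k. \<rho> ^ k * pi" and N = 0])
  show "summable (\<lambda>k. \<rho> ^ k * pi)"
    using assms by (intro summable_mult2 summable_geometric) simp
  show "norm (\<rho> ^ Suc k * kgram_angle \<Sigma> (Suc k) S T) \<le> \<rho> ^ k * pi" for k
  proof -
    have "\<rho> ^ Suc k \<le> \<rho> ^ k" using assms by (intro power_decreasing) auto
    then have "\<rho> ^ Suc k * kgram_angle \<Sigma> (Suc k) S T \<le> \<rho> ^ k * pi"
      using assms angle_on_bounds unfolding kgram_angle_def by (intro mult_mono) auto
    moreover have "0 \<le> \<rho> ^ Suc k * kgram_angle \<Sigma> (Suc k) S T"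
      using assms angle_on_bounds unfolding kgram_angle_def by (intro mult_nonneg_nonneg) auto
    ultimately show ?thesis by simp
  qed
qed

lemma A_series_summable:
  assumes "0 < \<rho>" "\<rho> < 1"
  shows "summable (\<lambda>k. \<rho> ^ Suc k * real (min (Suc k) M))"
proof (rule summable_comparison_test'[where g = "\<lambda>k. \<rho> ^ k * real M" and N = 0])
  show "summable (\<lambda>k. \<rho> ^ k * real M)"
    using assms by (intro summable_mult2 summable_geometric) simp
  show "norm (\<rho> ^ Suc k * real (min (Suc k) M)) \<le> \<rho> ^ k * real M" for k
  proof -
    have "\<rho> ^ Suc k \<le> \<rho> ^ k" using assms by (intro power_decreasing) auto
    then have "\<rho> ^ Suc k * real (min (Suc k) M) \<le> \<rho> ^ k * real M"
      using assms by (intro mult_mono) auto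
    then show ?thesis using assms by (simp add: abs_mult)
  qed
qed

end

theory Submission
  imports Defs
begin

text \<open>
  Write \<open>U = P1 @ Q\<close>, \<open>V = P2\<close> and \<open>W = Q\<^sup>l\<^sup>-\<^sup>1\<close>. Passing from \<open>P1 @ Q @ P2\<close> to \<open>P1 @ Q\<^sup>l @ P2\<close> is
  passing from \<open>U @ V\<close> to \<open>U @ W @ V\<close>, the insertion of a block of \<open>r\<close> letters at a single cut.

  Occurrences of \<open>k\<close>-grams inside \<open>U\<close> or inside \<open>V\<close> survive the insertion
  (\<open>multiplicity_append_ge\<close>). The other occurrences in \<open>U @ V\<close> straddle the cut, and there are at
  most \<open>min k M\<close> of them; in \<open>U @ W @ V\<close> there are \<open>r\<close> more, since a string of length \<open>N\<close> has
  \<open>N + 1 - k\<close> occurrences of \<open>k\<close>-grams in total (\<open>sum_multiplicity_words\<close>). So the two count vectors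
  are at \<open>L1\<close>-distance, hence also at Euclidean distance, at most \<open>2 * min k M + r\<close>
  (\<open>l1_insertion\<close>).

  Distances turn into angles through two inequalities. If \<open>t\<close> is the angle between \<open>u\<close> and \<open>v\<close>, then
  \<open>\<bar>u\<bar> * sin t\<close> is the distance from \<open>u\<close> to the line through \<open>v\<close>, hence at most \<open>\<bar>u - v\<bar>\<close>; and
  \<open>t \<le> pi / 2 * sin t\<close> for angles up to \<open>pi / 2\<close>, which all angles between nonnegative vectors are
  (\<open>angle_le_distance\<close>). The count vector of \<open>U @ V\<close> is long: its entries are integers, so
  its squared norm is at least the sum \<open>L + 1 - k\<close> of its entries, which is at least \<open>L / 2\<close> for \<open>k \<le> K\<close>.
  This bounds the angle for such \<open>k\<close> by \<open>pi / sqrt (2 * L) * (2 * min k M + r)\<close>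
  (\<open>kgram_angle_insertion\<close>), and for \<open>k > K\<close> the angle is at most \<open>pi / 2\<close>. Summing these bounds
  against \<open>\<rho>\<^sup>k\<close> gives \<open>d_rho_insertion\<close>.

  The closed form of \<open>A_series\<close> comes from writing \<open>min k M\<close> as the number of \<open>j < M\<close> with \<open>j < k\<close>,
  which turns the series into a sum of \<open>M\<close> geometric tails.
\<close>

section \<open>Occurrences of words in concatenations\<close>

lemma finite_occurrences: "finite {(R1, R2). S = R1 @ X @ R2}"
proof (rule finite_subset)
  show "{(R1, R2). S = R1 @ X @ R2} \<subseteq> (\<lambda>i. (take i S, drop (i + length X) S)) ` {..length S}"
  proof clarify
    fix R1 R2 :: "'a list"
    show "(R1, R2) \<in> (\<lambda>i. (take i (R1 @ X @ R2), drop (i + length X) (R1 @ X @ R2))) ` {..length (R1 @ X @ R2)}"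
      by (rule image_eqI[where x = "length R1"]) auto
  qed
qed simp

text \<open>Occurrences inside \<open>U\<close> and inside \<open>V\<close> remain occurrences in \<open>U @ V\<close>. No occurrence arises in
  both ways, because a nonempty word inside \<open>U\<close> begins before \<open>V\<close> does; the empty word at the cut
  would be counted twice.\<close>

lemma multiplicity_append_ge:
  assumes "X \<noteq> []"
  shows "multiplicity U X + multiplicity V X \<le> multiplicity (U @ V) X"
proof -
  let ?O = "\<lambda>S. {(R1, R2). S = R1 @ X @ R2}"
  let ?f = "\<lambda>(R1, R2). (R1, R2 @ V)" and ?g = "\<lambda>(R1, R2). (U @ R1, R2)"
  have "card (?O U) + card (?O V) = card (?f ` ?O U) + card (?g ` ?O V)"
    by (subst (1 2) card_image) (auto simp: inj_on_def)
  also have "\<dots> = card (?f ` ?O U \<union> ?g ` ?O V)"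
    using assms by (intro card_Un_disjoint[symmetric] finite_imageI finite_occurrences)
      (auto dest: arg_cong[where f = length])
  also have "\<dots> \<le> card (?O (U @ V))"
    by (intro card_mono finite_occurrences) auto
  finally show ?thesis by (simp add: multiplicity_def)
qed

text \<open>An occurrence of a word of length \<open>k\<close> is determined by its starting position, and each of the
  positions \<open>0, \<dots>, length S - k\<close> starts one. The truncated subtraction makes the count \<open>0\<close> when \<open>S\<close> is
  too short.\<close>

lemma sum_multiplicity_words:
  assumes "finite \<Sigma>" "S \<in> lists \<Sigma>"
  shows "(\<Sum>X\<in>words \<Sigma> k. multiplicity S X) = Suc (length S) - k"
proof -
  let ?O = "\<lambda>X. {(R1, R2). S = R1 @ X @ R2}"
  let ?h = "\<lambda>(X :: 'a list, R1 :: 'a list, R2 :: 'a list). length R1"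
  have "finite (words \<Sigma> k)"
    unfolding words_def by (rule finite_lists_length_eq) fact
  then have "(\<Sum>X\<in>words \<Sigma> k. multiplicity S X) = card (SIGMA X:words \<Sigma> k. ?O X)"
    by (simp add: multiplicity_def finite_occurrences)
  also have "\<dots> = card {..<Suc (length S) - k}"
  proof (rule bij_betw_same_card[of ?h], rule bij_betw_imageI)
    show "inj_on ?h (SIGMA X:words \<Sigma> k. ?O X)"
    proof (rule inj_onI)
      fix p q
      assume pq: "p \<in> (SIGMA X:words \<Sigma> k. ?O X)" "q \<in> (SIGMA X:words \<Sigma> k. ?O X)" "?h p = ?h q"
      obtain X R1 R2 X' R1' R2' where p: "p = (X, R1, R2)" and q: "q = (X', R1', R2')"
        by (metis prod_cases3)
      have "R1 @ X @ R2 = R1' @ X' @ R2'" "length R1 = length R1'" "length X = length X'"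
        using pq by (simp_all add: p q words_def)
      then show "p = q" by (simp add: p q)
    qed
    have "i \<in> ?h ` (SIGMA X:words \<Sigma> k. ?O X)" if "i < Suc (length S) - k" for i
    proof (rule image_eqI)
      show "i = ?h (take k (drop i S), take i S, drop k (drop i S))" using that by simp
      have "set (take k (drop i S)) \<subseteq> set S"
        by (meson order_trans set_drop_subset set_take_subset)
      then show "(take k (drop i S), take i S, drop k (drop i S)) \<in> (SIGMA X:words \<Sigma> k. ?O X)"
        using that assms(2) by (auto simp: words_def append_take_drop_id simp del: drop_drop)
    qed
    then show "?h ` (SIGMA X:words \<Sigma> k. ?O X) = {..<Suc (length S) - k}"
      by (auto simp: words_def)
  qed
  finally show ?thesis by simp
qed

text \<open>Both count vectors dominate the sum \<open>c\<close> of the count vectors of \<open>U\<close> and \<open>V\<close>, so they differ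
  entrywise by at most what they have in excess of \<open>c\<close>. The total excess of \<open>U @ V\<close> is the number of
  occurrences that straddle the cut; these begin at one of the last \<open>k - 1\<close> letters of \<open>U\<close> and end at
  one of the first \<open>k - 1\<close> letters of \<open>V\<close>. The total excess of \<open>U @ W @ V\<close> is larger by \<open>length W\<close>.\<close>

lemma l1_insertion:
  assumes "finite \<Sigma>" and "U \<in> lists \<Sigma>" "V \<in> lists \<Sigma>" "W \<in> lists \<Sigma>"
    and "1 \<le> k" "k \<le> length (U @ V)"
  shows "(\<Sum>X\<in>words \<Sigma> k. \<bar>kgram_vec (U @ V) X - kgram_vec (U @ W @ V) X\<bar>)
    \<le> 2 * real (min k (min (length U + 1) (length V + 1))) + real (length W)"
proof -
  let ?c = "\<lambda>S X. real (multiplicity S X)"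
  have total: "(\<Sum>X\<in>words \<Sigma> k. ?c S X) = real (Suc (length S) - k)" if "S \<in> lists \<Sigma>" for S
    using sum_multiplicity_words[OF assms(1) that, of k] by (metis of_nat_sum)
  have "\<bar>?c (U @ V) X - ?c (U @ W @ V) X\<bar>
      \<le> ?c (U @ V) X + ?c (U @ W @ V) X - 2 * (?c U X + ?c V X)" if "X \<in> words \<Sigma> k" for X
  proof -
    have "X \<noteq> []" using that assms(5) by (auto simp: words_def)
    then show ?thesis
      using multiplicity_append_ge[of X U V] multiplicity_append_ge[of X U "W @ V"]
        multiplicity_append_ge[of X W V] by simp
  qed
  then have "(\<Sum>X\<in>words \<Sigma> k. \<bar>?c (U @ V) X - ?c (U @ W @ V) X\<bar>)
      \<le> (\<Sum>X\<in>words \<Sigma> k. ?c (U @ V) X + ?c (U @ W @ V) X - 2 * (?c U X + ?c V X))"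
    by (rule sum_mono)
  also have "\<dots> = real (Suc (length (U @ V)) - k) + real (Suc (length (U @ W @ V)) - k)
      - 2 * (real (Suc (length U) - k) + real (Suc (length V) - k))"
    using assms(2-4) by (simp add: sum.distrib sum_subtractf total flip: sum_distrib_left)
  also have "\<dots> \<le> 2 * real (min k (min (length U + 1) (length V + 1))) + real (length W)"
  proof -
    have "Suc (length (U @ V)) - k \<le> min k (min (length U + 1) (length V + 1))
        + (Suc (length U) - k) + (Suc (length V) - k)"
      using assms(5,6) by (cases "k \<le> length U"; cases "k \<le> length V") simp_all
    moreover have "Suc (length (U @ W @ V)) - k = Suc (length (U @ V)) - k + length W"
      using assms(6) by simp
    moreover have "real x + real y - 2 * (real a + real b) \<le> 2 * real m + real w"
      if "x \<le> m + a + b" "y = x + w" for x y a b m w :: nat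
      using of_nat_mono[where 'a = real, OF that(1)] that(2) by simp
    ultimately show ?thesis by blast
  qed
  finally show ?thesis by (simp add: kgram_vec_def)
qed

section \<open>Angles between nonnegative vectors\<close>

text \<open>Jordan's inequality: the concave function \<open>sin\<close> lies above its chord from \<open>0\<close> to \<open>pi / 2\<close>.\<close>

lemma le_half_pi_sin:
  assumes "0 \<le> x" "x \<le> pi / 2"
  shows "x \<le> pi / 2 * sin x"
proof -
  have "concave_on {0..pi} sin"
    by (rule f''_le0_imp_concave[where f' = cos and f'' = "\<lambda>x. - sin x"])
      (auto intro!: derivative_eq_intros sin_ge_zero)
  from concave_onD[OF this, of "2 * x / pi" 0 "pi/2"] assms
  show ?thesis by (simp add: field_simps)
qed

lemma angle_le_half_pi:
  assumes "\<And>i. i \<in> I \<Longrightarrow> 0 \<le> u i" "\<And>i. i \<in> I \<Longrightarrow> 0 \<le> v i"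
  shows "angle_on I u v \<le> pi / 2"
proof -
  have "0 \<le> (\<Sum>i\<in>I. u i * v i) / (L2_set u I * L2_set v I)"
    using assms by (intro divide_nonneg_nonneg mult_nonneg_nonneg sum_nonneg) auto
  moreover have "(\<Sum>i\<in>I. u i * v i) \<le> L2_set u I * L2_set v I"
    using L2_set_mult_ineq[of u v I] assms by simp
  then have "(\<Sum>i\<in>I. u i * v i) / (L2_set u I * L2_set v I) \<le> 1"
    by (auto simp: divide_le_eq_1 less_le intro: L2_set_nonneg)
  ultimately have "arccos ((\<Sum>i\<in>I. u i * v i) / (L2_set u I * L2_set v I)) \<le> pi / 2"
    by (rule arccos_le_pi2)
  then show ?thesis
    by (simp add: angle_on_def)
qed

text \<open>The distance from \<open>u\<close> to the line through \<open>v\<close> is \<open>\<bar>u\<bar> * sin t\<close>, where \<open>t\<close> is the angle; it is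
  at most the distance from \<open>u\<close> to \<open>v\<close>. Jordan's inequality replaces \<open>sin t\<close> by \<open>t\<close>. For \<open>v = 0\<close> the
  conventional angle \<open>pi / 2\<close> attains the bound.\<close>

lemma angle_le_distance:
  assumes "finite I" "\<And>i. i \<in> I \<Longrightarrow> 0 \<le> u i" "\<And>i. i \<in> I \<Longrightarrow> 0 \<le> v i"
    and "\<not> zero_vec_on I u"
  shows "angle_on I u v \<le> pi / 2 * (L2_set (\<lambda>i. u i - v i) I / L2_set u I)"
proof -
  define a b p where "a = L2_set u I" and "b = L2_set v I" and "p = (\<Sum>i\<in>I. u i * v i)"
  define d where "d = L2_set (\<lambda>i. u i - v i) I"
  have "a > 0"
    using assms(1,4) L2_set_eq_0_iff[of I u] L2_set_nonneg[of u I]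
    unfolding a_def zero_vec_on_def by linarith
  show ?thesis
  proof (cases "zero_vec_on I v")
    case True
    then have "d = a" unfolding a_def d_def by (auto simp: zero_vec_on_def intro: L2_set_cong)
    then show ?thesis using True assms(4) \<open>a > 0\<close>
      by (simp add: angle_on_def flip: a_def d_def)
  next
    case False
    then have "b > 0"
      using assms(1) L2_set_eq_0_iff[of I v] L2_set_nonneg[of v I]
      unfolding b_def zero_vec_on_def by linarith
    define c where "c = p / (a * b)"
    define t where "t = angle_on I u v"
    have t: "t = arccos c"
      using False assms(4) by (simp add: t_def angle_on_def c_def a_def b_def p_def)
    have "0 \<le> p" unfolding p_def using assms by (simp add: sum_nonneg)
    moreover have "p \<le> a * b"
      using L2_set_mult_ineq[of u v I] assms by (simp add: p_def a_def b_def)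
    ultimately have c: "0 \<le> c" "c \<le> 1"
      using \<open>a > 0\<close> \<open>b > 0\<close> by (simp_all add: c_def)
    have sq: "L2_set f I ^ 2 = (\<Sum>i\<in>I. (f i)\<^sup>2)" for f
      by (simp add: L2_set_def sum_nonneg)
    have "d\<^sup>2 = a\<^sup>2 - 2 * p + b\<^sup>2"
      by (simp add: d_def a_def b_def p_def sq power2_diff sum.distrib sum_subtractf
          sum_distrib_left mult.assoc)
    also have "p = a * b * c" using \<open>a > 0\<close> \<open>b > 0\<close> by (simp add: c_def)
    \<comment> \<open>Pythagoras: \<open>a * c\<close> is the length of the projection of \<open>u\<close> to the line through \<open>v\<close>.\<close>
    finally have "d\<^sup>2 = (b - a * c)\<^sup>2 + a\<^sup>2 * (1 - c\<^sup>2)"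
      by (simp add: power2_eq_square algebra_simps)
    moreover have "a\<^sup>2 * (1 - c\<^sup>2) = (a * sin t)\<^sup>2"
      using c by (simp add: t power_mult_distrib sin_squared_eq)
    ultimately have "(a * sin t)\<^sup>2 \<le> d\<^sup>2" by simp
    then have "a * sin t \<le> d"
      by (rule power2_le_imp_le) (simp add: d_def)
    then have "sin t \<le> d / a" using \<open>a > 0\<close> by (simp add: field_simps)
    then have "pi / 2 * sin t \<le> pi / 2 * (d / a)" by (intro mult_left_mono) auto
    moreover have "t \<le> pi / 2 * sin t"
      unfolding t_def
      using angle_on_bounds[of I u v] angle_le_half_pi[of I u v] assms(2,3)
      by (intro le_half_pi_sin) auto
    ultimately show ?thesis by (simp add: t_def a_def d_def)
  qed
qed

section \<open>The angle after inserting a block\<close>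

text \<open>Natural numbers are at most their squares, so the squared norm is at least the sum of the
  entries.\<close>

lemma L2_kgram_vec_ge:
  assumes "finite \<Sigma>" "S \<in> lists \<Sigma>"
  shows "sqrt (real (Suc (length S) - k)) \<le> L2_set (kgram_vec S) (words \<Sigma> k)"
proof -
  have "real (Suc (length S) - k) = (\<Sum>X\<in>words \<Sigma> k. real (multiplicity S X))"
    using sum_multiplicity_words[OF assms, of k] by (metis of_nat_sum)
  also have "\<dots> \<le> (\<Sum>X\<in>words \<Sigma> k. (kgram_vec S X)\<^sup>2)"
  proof (rule sum_mono)
    fix X
    have "real (multiplicity S X) \<le> real (multiplicity S X * multiplicity S X)"
      by (rule of_nat_mono) (rule le_square)
    then show "real (multiplicity S X) \<le> (kgram_vec S X)\<^sup>2"
      by (simp add: kgram_vec_def power2_eq_square)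
  qed
  finally show ?thesis by (simp add: L2_set_def)
qed

text \<open>The factor in front is \<open>pi / 2\<close> divided by \<open>sqrt (L / 2)\<close>, the lower bound for the norm of the
  count vector of \<open>U @ V\<close> that holds when \<open>k \<le> L / 2\<close>.\<close>

lemma kgram_angle_insertion:
  assumes "finite \<Sigma>" and "U \<in> lists \<Sigma>" "V \<in> lists \<Sigma>" "W \<in> lists \<Sigma>"
    and "1 \<le> k" "2 * k \<le> length (U @ V)"
  shows "kgram_angle \<Sigma> k (U @ V) (U @ W @ V) \<le> pi / sqrt (2 * real (length (U @ V)))
    * (2 * real (min k (min (length U + 1) (length V + 1))) + real (length W))"
proof -
  let ?I = "words \<Sigma> k" and ?u = "kgram_vec (U @ V)" and ?v = "kgram_vec (U @ W @ V)"
  let ?B = "2 * real (min k (min (length U + 1) (length V + 1))) + real (length W)"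
  define L where "L = length (U @ V)"
  have "L > 0" using assms(5,6) unfolding L_def by linarith
  have fin: "finite ?I"
    unfolding words_def using assms(1) by (rule finite_lists_length_eq)
  have "sqrt (real L / 2) \<le> sqrt (real (Suc L - k))"
    using assms(6) by (simp add: L_def)
  also have "\<dots> \<le> L2_set ?u ?I"
    unfolding L_def using assms(1-3) by (intro L2_kgram_vec_ge) auto
  finally have norm: "sqrt (real L / 2) \<le> L2_set ?u ?I" .
  moreover have "0 < sqrt (real L / 2)" using \<open>L > 0\<close> by simp
  ultimately have "\<not> zero_vec_on ?I ?u"
    using L2_set_0'[of ?I ?u] unfolding zero_vec_on_def by linarith
  then have "kgram_angle \<Sigma> k (U @ V) (U @ W @ V)
      \<le> pi / 2 * (L2_set (\<lambda>X. ?u X - ?v X) ?I / L2_set ?u ?I)"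
    unfolding kgram_angle_def using fin by (intro angle_le_distance) (auto simp: kgram_vec_def)
  also have "L2_set (\<lambda>X. ?u X - ?v X) ?I \<le> ?B"
    using L2_set_le_sum_abs[of "\<lambda>X. ?u X - ?v X" ?I] l1_insertion[OF assms(1-5)] assms(5,6)
    by simp
  then have "pi / 2 * (L2_set (\<lambda>X. ?u X - ?v X) ?I / L2_set ?u ?I) \<le> pi / 2 * (?B / sqrt (real L / 2))"
    using norm \<open>0 < sqrt (real L / 2)\<close> by (intro mult_left_mono frac_le) auto
  also have "sqrt (real L / 2) = sqrt (2 * real L) / 2"
    by (simp add: real_sqrt_divide real_sqrt_mult field_simps)
  also have "pi / 2 * (?B / (sqrt (2 * real L) / 2)) = pi / sqrt (2 * real L) * ?B"
    using \<open>L > 0\<close> by (simp add: divide_simps)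
  finally show ?thesis unfolding L_def .
qed

section \<open>Summation over the word length\<close>

lemma geometric_tail_sums:
  fixes \<rho> :: real
  assumes "0 < \<rho>" "\<rho> < 1"
  shows "(\<lambda>k. if N \<le> k then \<rho> ^ Suc k else 0) sums (\<rho> ^ Suc N / (1 - \<rho>))"
proof -
  have "(\<lambda>k. \<rho> ^ Suc N * \<rho> ^ k) sums (\<rho> ^ Suc N * (1 / (1 - \<rho>)))"
    using assms by (intro sums_mult geometric_sums) simp
  then have "(\<lambda>k. if N \<le> k + N then \<rho> ^ Suc (k + N) else 0) sums (\<rho> ^ Suc N / (1 - \<rho>))"
    by (simp add: power_add mult_ac)
  then show ?thesis by (subst (asm) sums_zero_iff_shift) auto
qed

text \<open>The factor \<open>min (Suc k) M\<close> counts the \<open>j < M\<close> with \<open>j \<le> k\<close>. Exchanging the two summations leaves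
  a geometric tail for each \<open>j\<close>, and these add up to \<open>\<rho> * (1 - \<rho> ^ M) / (1 - \<rho>)\<^sup>2\<close>.\<close>

lemma A_series_closed_form:
  assumes "0 < \<rho>" "\<rho> < 1"
  shows "A_series M \<rho> = \<rho> * (1 - (real M + 1) * \<rho> ^ M + real M * \<rho> ^ (M + 1)) / (1 - \<rho>)\<^sup>2
    + real M * \<rho> ^ (M + 1) / (1 - \<rho>)"
proof -
  have "(\<lambda>k. \<Sum>j<M. if j \<le> k then \<rho> ^ Suc k else 0) sums (\<Sum>j<M. \<rho> ^ Suc j / (1 - \<rho>))"
    using assms by (intro sums_sum geometric_tail_sums)
  moreover have "(\<Sum>j<M. if j \<le> k then \<rho> ^ Suc k else 0) = \<rho> ^ Suc k * real (min (Suc k) M)" for k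
  proof -
    have "{..<M} \<inter> {j. j \<le> k} = {..<min (Suc k) M}" by auto
    then show ?thesis by (simp add: sum.If_cases)
  qed
  ultimately have "A_series M \<rho> = (\<Sum>j<M. \<rho> ^ Suc j / (1 - \<rho>))"
    by (simp add: A_series_def sums_iff)
  also have "\<dots> = \<rho> / (1 - \<rho>) * (\<Sum>j<M. \<rho> ^ j)"
    by (simp add: sum_distrib_left)
  also have "\<dots> = \<rho> * (1 - \<rho> ^ M) / (1 - \<rho>)\<^sup>2"
    using assms by (simp add: sum_gp_strict power2_eq_square)
  also have "\<dots> = \<rho> * (1 - (real M + 1) * \<rho> ^ M + real M * \<rho> ^ (M + 1)) / (1 - \<rho>)\<^sup>2
    + real M * \<rho> ^ (M + 1) / (1 - \<rho>)"
    using assms by (simp add: divide_simps power2_eq_square) (simp add: algebra_simps)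
  finally show ?thesis .
qed

text \<open>Word lengths up to \<open>L div 2\<close> are bounded by \<open>kgram_angle_insertion\<close>, and all longer ones by a
  right angle.\<close>

lemma d_rho_insertion:
  assumes "finite \<Sigma>" "0 < \<rho>" "\<rho> < 1"
    and "U \<in> lists \<Sigma>" "V \<in> lists \<Sigma>" "W \<in> lists \<Sigma>"
    and "L = length (U @ V)" and "M = min (length U + 1) (length V + 1)"
  shows "d_rho \<Sigma> \<rho> (U @ V) (U @ W @ V)
    \<le> pi / sqrt (2 * real L) * (2 * A_series M \<rho> + \<rho> / (1 - \<rho>) * real (length W))
      + pi / 2 * (\<rho> ^ (L div 2 + 1) / (1 - \<rho>))"
proof -
  let ?C = "pi / sqrt (2 * real L)" and ?r = "real (length W)"
  \<comment> \<open>The condition \<open>0 \<le> k\<close> puts the plain geometric series in the form of a tail. The index \<open>k\<close> stands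
    for word length \<open>Suc k\<close>, so long words are those with \<open>L div 2 \<le> k\<close>.\<close>
  let ?g = "\<lambda>k. ?C * (2 * (\<rho> ^ Suc k * real (min (Suc k) M)) + (if 0 \<le> k then \<rho> ^ Suc k else 0) * ?r)
    + pi / 2 * (if L div 2 \<le> k then \<rho> ^ Suc k else 0)"
  have "?g sums (?C * (2 * A_series M \<rho> + \<rho> ^ Suc 0 / (1 - \<rho>) * ?r)
      + pi / 2 * (\<rho> ^ Suc (L div 2) / (1 - \<rho>)))"
    unfolding A_series_def using assms(2,3)
    by (intro sums_add sums_mult sums_mult2 geometric_tail_sums summable_sums A_series_summable)
  moreover have "\<rho> ^ Suc k * kgram_angle \<Sigma> (Suc k) (U @ V) (U @ W @ V) \<le> ?g k" for k
  proof (cases "L div 2 \<le> k")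
    case True
    have "kgram_angle \<Sigma> (Suc k) (U @ V) (U @ W @ V) \<le> pi / 2"
      unfolding kgram_angle_def by (rule angle_le_half_pi) (auto simp: kgram_vec_def)
    then have "\<rho> ^ Suc k * kgram_angle \<Sigma> (Suc k) (U @ V) (U @ W @ V) \<le> \<rho> ^ Suc k * (pi / 2)"
      using assms(2) by (intro mult_left_mono) auto
    moreover have "0 \<le> ?C * (2 * (\<rho> ^ Suc k * real (min (Suc k) M)) + \<rho> ^ Suc k * ?r)"
      using assms(2) by (intro mult_nonneg_nonneg add_nonneg_nonneg) auto
    ultimately show ?thesis using True by (simp add: mult.commute)
  next
    case False
    then have "2 * Suc k \<le> length (U @ V)" using assms(7) by simp
    then have "kgram_angle \<Sigma> (Suc k) (U @ V) (U @ W @ V) \<le> ?C * (2 * real (min (Suc k) M) + ?r)"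
      unfolding assms(7,8) using assms(1,4-6) by (intro kgram_angle_insertion) auto
    then have "\<rho> ^ Suc k * kgram_angle \<Sigma> (Suc k) (U @ V) (U @ W @ V)
        \<le> \<rho> ^ Suc k * (?C * (2 * real (min (Suc k) M) + ?r))"
      using assms(2) by (intro mult_left_mono) auto
    also have "\<dots> = ?g k" using False by (simp add: algebra_simps)
    finally show ?thesis .
  qed
  ultimately show ?thesis
    unfolding d_rho_def
    using suminf_le[OF _ d_rho_summable[OF assms(2,3)], of \<Sigma> "U @ V" "U @ W @ V" ?g]
    by (simp only: sums_iff) simp
qed

theorem theorem7p4:
  fixes \<Sigma> :: "'a set" and \<rho> :: real and P1 P2 Q :: "'a list"
    and l m1 m2 n L r K M :: nat
  assumes "finite \<Sigma>"
    and "0 < \<rho>" and "\<rho> < 1"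
    and "P1 \<in> lists \<Sigma>" and "P2 \<in> lists \<Sigma>" and "Q \<in> lists \<Sigma>"
    and "length P1 = m1" and "length P2 = m2" and "length Q = n"
    and "l \<ge> 1"
    and "L = m1 + n + m2"
    and "r = (l - 1) * n"
    and "K = L div 2"
    and "M = min (m1 + n + 1) (m2 + 1)"
  shows "d_rho \<Sigma> \<rho> (P1 @ Q @ P2) (P1 @ word_power Q l @ P2)
           \<le> pi / sqrt (2 * real L) * (3 * A_series M \<rho> + \<rho> / (1 - \<rho>) * real r)
             + pi / 2 * (\<rho> ^ (K + 1) / (1 - \<rho>))
             + pi / 2 * (\<rho> ^ (L + 1) * (1 - \<rho> ^ r) / (1 - \<rho>))
         \<and> A_series M \<rho> =
             \<rho> * (1 - (real M + 1) * \<rho> ^ M + real M * \<rho> ^ (M + 1)) / (1 - \<rho>)\<^sup>2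
             + real M * \<rho> ^ (M + 1) / (1 - \<rho>)"
proof
  define W where "W = word_power Q (l - 1)"
  have "word_power Q l = Q @ W"
    using assms(10) by (cases l) (simp_all add: W_def word_power_def)
  have W: "length W = r" "W \<in> lists \<Sigma>"
    using assms by (auto simp: W_def word_power_def length_concat sum_list_replicate)
  have "d_rho \<Sigma> \<rho> (P1 @ Q @ P2) (P1 @ word_power Q l @ P2)
      \<le> pi / sqrt (2 * real L) * (2 * A_series M \<rho> + \<rho> / (1 - \<rho>) * real r)
        + pi / 2 * (\<rho> ^ (K + 1) / (1 - \<rho>))"
    using d_rho_insertion[of \<Sigma> \<rho> "P1 @ Q" P2 W L M] assms W
    by (simp add: \<open>word_power Q l = Q @ W\<close>)
  also have "\<dots> \<le> pi / sqrt (2 * real L) * (3 * A_series M \<rho> + \<rho> / (1 - \<rho>) * real r)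
        + pi / 2 * (\<rho> ^ (K + 1) / (1 - \<rho>))"
  proof -
    have "0 \<le> A_series M \<rho>"
      unfolding A_series_def using assms(2,3) by (intro suminf_nonneg A_series_summable) auto
    then show ?thesis by (intro add_right_mono mult_left_mono) auto
  qed
  also have "\<dots> \<le> \<dots> + pi / 2 * (\<rho> ^ (L + 1) * (1 - \<rho> ^ r) / (1 - \<rho>))"
  proof -
    have "\<rho> ^ r \<le> 1" using assms(2,3) by (simp add: power_le_one)
    then show ?thesis using assms(2,3) by simp
  qed
  finally show "d_rho \<Sigma> \<rho> (P1 @ Q @ P2) (P1 @ word_power Q l @ P2)
      \<le> pi / sqrt (2 * real L) * (3 * A_series M \<rho> + \<rho> / (1 - \<rho>) * real r)
        + pi / 2 * (\<rho> ^ (K + 1) / (1 - \<rho>))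
        + pi / 2 * (\<rho> ^ (L + 1) * (1 - \<rho> ^ r) / (1 - \<rho>))" .
qed (rule A_series_closed_form[OF assms(2,3)])

end
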